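(* For every $\beta\in[0,1]$, $\;C^2_{maxmin}(\beta)\ \ge\ C_{maxmin}(\beta)$.
   Context: Total-energy model. Time is slotted with slots $1,\dots,T$; $[k,l]$ denotes the set of slots $\{k,\dots,l\}$. There are $n\ge1$ jobs $J=\{1,\dots,n\}$; job $j$ has demand $(a_j,d_j,e_j)$ with $a_j,d_j\in\{1,\dots,T\}$, $a_j\le d_j$, $e_j>0$ (arrival slot, deadline slot, total energy). The cost function $C:[0,\infty)\to[0,\infty)$ is non-decreasing and convex. For a finite family of demands $(a'_i,d'_i,e'_i)$, $i\in J'=\{1,\dots,m\}$: - the operator's optimal cost is $C_{min}(a',d',e')=\min_{\mathcal S}\sum_{t=1}^TC(\sum_{i\in J'}\mathcal S_{it})$ over $\mathcal S_{it}\ge0$ with $\sum_{t=a'_i}^{d'_i}\mathcal S_{it}=e'_i$ for all $i$; - the baseline cost, when the operator serves each demand entirely and immediately upon its arrival, is $C_{base}(a',d',e')=\sum_{t\in\{0,\dots,T\}}C\big(\sum_{i\in J':a'_i=t}e'_i\big)$. Attack: the attacker replaces each job $j$ by a finite collection $b_j$ of (sub)jobs $(a'_k,d'_k,e'_k)$, with $a'_k,d'_k$ positive integers, $e'_k\ge0$, $a_j\le a'_k\le d'_k\le d_j$ and $\sum_{k}e'_k=e_j$; the forged family is the union of all $b_j$, and $J^*=\{j\in J:b_j\ne\{(a_j,d_j,e_j)\}\}$ is the set of modified jobs. For $\beta\in[0,1]$, both of the following are maxima over all attacks with $|J^*|\le\beta n$: $C_{maxmin}(\beta)$ is the maximum of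 $C_{min}(a',d',e')$, and $C^2_{maxmin}(\beta)$ is the maximum of $C_{base}(a',d',e')$ (the operator following the baseline strategy). *)

theory Defs
  imports "HOL-Analysis.Analysis"
begin

datatype demand = Demand (arrival: nat) (deadline: nat) (energy: real)

text \<open>
  A finite family of demands is a list \<open>ds\<close>, indexed by \<open>i < length ds\<close>; repeated demands count
  with multiplicity, and none of the notions below depends on the order of the list.
  As usual, \<open>S i t\<close> is the energy given to demand \<open>i\<close> in slot \<open>t\<close>; only the values with
  \<open>i < length ds\<close> and \<open>1 \<le> t \<le> T\<close> matter.
\<close>

definition feasible :: "nat \<Rightarrow> demand list \<Rightarrow> (nat \<Rightarrow> nat \<Rightarrow> real) \<Rightarrow> bool" where
  "feasible T ds S \<longleftrightarrow>
     (\<forall>i<length ds. \<forall>t\<in>{1..T}. 0 \<le> S i t) \<and>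
     (\<forall>i<length ds. (\<Sum>t = arrival (ds ! i)..deadline (ds ! i). S i t) = energy (ds ! i))"

definition schedule_cost ::
  "(real \<Rightarrow> real) \<Rightarrow> nat \<Rightarrow> demand list \<Rightarrow> (nat \<Rightarrow> nat \<Rightarrow> real) \<Rightarrow> real" where
  "schedule_cost C T ds S = (\<Sum>t = 1..T. C (\<Sum>i<length ds. S i t))"

text \<open>
  Minima and maxima over infinite sets of reals are written with \<open>LEAST\<close> and \<open>GREATEST\<close>, which,
  unlike \<open>Inf\<close> and \<open>Sup\<close>, denote attained extrema. For a convex, non-decreasing cost function
  on \<open>[0, \<infinity>)\<close> (which is then continuous there) they all exist: the minimum by compactness;
  the maxima because both costs are convex in the energies of the subjobs, so that it is enough to
  consider the finitely many attacks replacing each modified job by a single subjob.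
\<close>

definition C_min :: "(real \<Rightarrow> real) \<Rightarrow> nat \<Rightarrow> demand list \<Rightarrow> real" where
  "C_min C T ds = (LEAST c. \<exists>S. feasible T ds S \<and> c = schedule_cost C T ds S)"

text \<open>The slot \<open>t = 0\<close>, in which no demand arrives, contributes \<open>C 0\<close>.\<close>

definition C_base :: "(real \<Rightarrow> real) \<Rightarrow> nat \<Rightarrow> demand list \<Rightarrow> real" where
  "C_base C T ds =
     (\<Sum>t\<in>{0..T}. C (\<Sum>i | i < length ds \<and> arrival (ds ! i) = t. energy (ds ! i)))"

definition replaces :: "demand list \<Rightarrow> demand \<Rightarrow> bool" where
  "replaces ks q \<longleftrightarrow>
     (\<forall>k\<in>set ks. 1 \<le> arrival k \<and> 1 \<le> deadline k \<and> 0 \<le> energy k \<and>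
        arrival q \<le> arrival k \<and> arrival k \<le> deadline k \<and> deadline k \<le> deadline q) \<and>
     (\<Sum>k\<leftarrow>ks. energy k) = energy q"

definition modified_jobs :: "nat \<Rightarrow> (nat \<Rightarrow> demand) \<Rightarrow> (nat \<Rightarrow> demand list) \<Rightarrow> nat set" where
  "modified_jobs n job b = {j \<in> {1..n}. b j \<noteq> [job j]}"

definition forged :: "nat \<Rightarrow> (nat \<Rightarrow> demand list) \<Rightarrow> demand list" where
  "forged n b = concat (map b [1..<Suc n])"

definition attack :: "nat \<Rightarrow> (nat \<Rightarrow> demand) \<Rightarrow> real \<Rightarrow> (nat \<Rightarrow> demand list) \<Rightarrow> bool" where
  "attack n job \<beta> b \<longleftrightarrow>
     (\<forall>j\<in>{1..n}. replaces (b j) (job j)) \<and>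
     real (card (modified_jobs n job b)) \<le> \<beta> * real n"

definition C_maxmin :: "(real \<Rightarrow> real) \<Rightarrow> nat \<Rightarrow> nat \<Rightarrow> (nat \<Rightarrow> demand) \<Rightarrow> real \<Rightarrow> real" where
  "C_maxmin C T n job \<beta> = (GREATEST c. \<exists>b. attack n job \<beta> b \<and> c = C_min C T (forged n b))"

definition C2_maxmin :: "(real \<Rightarrow> real) \<Rightarrow> nat \<Rightarrow> nat \<Rightarrow> (nat \<Rightarrow> demand) \<Rightarrow> real \<Rightarrow> real" where
  "C2_maxmin C T n job \<beta> = (GREATEST c. \<exists>b. attack n job \<beta> b \<and> c = C_base C T (forged n b))"

end

theory Submission
  imports Defs
begin

text \<open>
  For a single family of demands the baseline is itself a feasible schedule, so its cost dominates
  the optimal one; hence the inequality between the two maxima, once both are known to be attained.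
  The optimal cost is the minimum of a continuous convex function over the compact convex set of
  load profiles. Up to the constant \<open>C 0\<close> of slot \<open>0\<close>, the baseline cost is the optimal cost after
  every deadline has been moved to the arrival, so one argument covers both maxima: by convexity,
  concentrating a modified job on one of its subjobs can be done without lowering the cost, which
  leaves finitely many attacks.
\<close>

section \<open>Load profiles of a family of demands\<close>

definition valid :: "nat \<Rightarrow> demand list \<Rightarrow> bool" where
  "valid T ds \<longleftrightarrow>
     (\<forall>k\<in>set ds. 1 \<le> arrival k \<and> arrival k \<le> deadline k \<and> deadline k \<le> T \<and> 0 \<le> energy k)"

text \<open>Profiles are total functions vanishing off the window, so that profiles of different
  demands live in one product space and add pointwise.\<close>

definition service :: "demand \<Rightarrow> (nat \<Rightarrow> real) set" where
  "service k = {x. (\<forall>t. 0 \<le> x t) \<and> (\<forall>t. t \<notin> {arrival k..deadline k} \<longrightarrow> x t = 0) \<and>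
     (\<Sum>t = arrival k..deadline k. x t) = energy k}"

text \<open>This is the Minkowski sum of the service sets. The cost sees a schedule only through its
  total load, so optimisation can take place here instead of over schedules.\<close>

primrec loads :: "demand list \<Rightarrow> (nat \<Rightarrow> real) set" where
  "loads [] = {\<lambda>_. 0}"
| "loads (k # ks) = (\<lambda>(x, y) t. x t + y t) ` (service k \<times> loads ks)"

lemma valid_simps [simp]:
  "valid T []"
  "valid T (k # ks) \<longleftrightarrow> 1 \<le> arrival k \<and> arrival k \<le> deadline k \<and> deadline k \<le> T \<and>
     0 \<le> energy k \<and> valid T ks"
  "valid T (xs @ ys) \<longleftrightarrow> valid T xs \<and> valid T ys"
  by (auto simp: valid_def)

lemma loads_nonneg: "x \<in> loads ds \<Longrightarrow> 0 \<le> x t"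
  by (induction ds arbitrary: x) (auto simp: service_def)

text \<open>By associativity of addition. It lets the block of one job be separated from the blocks
  before and after it.\<close>

lemma loads_append:
  "loads (xs @ ys) = (\<lambda>(x, y) t. x t + y t) ` (loads xs \<times> loads ys)"
proof (induction xs)
  case Nil
  show ?case by (force simp: image_def)
next
  case (Cons k xs)
  show ?case
    unfolding append_Cons loads.simps Cons.IH
    by (fastforce simp: image_def add.assoc)
qed

lemma loads_appendI:
  "x \<in> loads xs \<Longrightarrow> y \<in> loads ys \<Longrightarrow> (\<lambda>t. x t + y t) \<in> loads (xs @ ys)"
  by (auto simp: loads_append)

section \<open>Compactness, nonemptiness and convexity of the load sets\<close>

lemma service_le_energy:
  assumes "x \<in> service k"
  shows "x t \<le> max 0 (energy k)"
proof (cases "t \<in> {arrival k..deadline k}")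
  case True
  then have "x t \<le> (\<Sum>t = arrival k..deadline k. x t)"
    using assms by (intro member_le_sum) (auto simp: service_def)
  then show ?thesis using assms by (auto simp: service_def)
qed (use assms in \<open>auto simp: service_def\<close>)

text \<open>By Tychonoff the box \<open>?K\<close> is compact; the defining conditions are closed,
  being equalities and inequalities between continuous functions of the coordinates.\<close>

lemma compact_service: "compact (service k)"
proof -
  let ?K = "PiE UNIV (\<lambda>_::nat. {0..max 0 (energy k)})"
  have "compactin (product_topology (\<lambda>_. euclidean) UNIV) ?K"
    by (subst compactin_PiE) auto
  then have K: "compact ?K"
    by (simp add: euclidean_product_topology)
  have coord: "continuous_on UNIV (\<lambda>x::nat \<Rightarrow> real. x t)" for t
    by (rule continuous_on_product_coordinates)
  let ?A = "\<Inter>t. {x::nat \<Rightarrow> real. 0 \<le> x t}"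
  let ?B = "\<Inter>t\<in>- {arrival k..deadline k}. {x::nat \<Rightarrow> real. x t = 0}"
  let ?D = "{x. (\<Sum>t = arrival k..deadline k. x t) = energy k}"
  have "closed ?A"
    by (intro closed_INT ballI closed_Collect_le coord continuous_on_const)
  moreover have "closed ?B"
    by (intro closed_INT ballI closed_Collect_eq coord continuous_on_const)
  moreover have "closed ?D"
    by (intro closed_Collect_eq continuous_on_sum coord continuous_on_const)
  ultimately have "compact (?K \<inter> (?A \<inter> ?B \<inter> ?D))"
    by (intro compact_Int_closed K closed_Int)
  moreover have "service k = ?K \<inter> (?A \<inter> ?B \<inter> ?D)"
  proof
    show "service k \<subseteq> ?K \<inter> (?A \<inter> ?B \<inter> ?D)"
      using service_le_energy[of _ k] by (fastforce simp: service_def PiE_def Pi_def)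
    show "?K \<inter> (?A \<inter> ?B \<inter> ?D) \<subseteq> service k"
      by (auto simp: service_def)
  qed
  ultimately show ?thesis by simp
qed

text \<open>Addition is continuous into the product space because each coordinate is, so a Minkowski
  sum of compact sets is compact.\<close>

lemma compact_loads: "compact (loads ds)"
proof (induction ds)
  case (Cons k ds)
  have coord: "continuous_on UNIV (\<lambda>x::nat \<Rightarrow> real. x t)" for t
    by (rule continuous_on_product_coordinates)
  have "continuous_on (service k \<times> loads ds)
      (\<lambda>p t. (case p of (x, y) \<Rightarrow> \<lambda>t. x t + y t) t :: real)"
    unfolding case_prod_beta
    by (intro continuous_on_coordinatewise_then_product continuous_on_add
        continuous_on_compose2[OF coord continuous_on_fst]
        continuous_on_compose2[OF coord continuous_on_snd] continuous_on_id subset_UNIV)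
  then show ?case
    using Cons.IH compact_service by (auto intro!: compact_continuous_image compact_Times)
qed simp

lemma service_nonempty:
  assumes "arrival k \<le> deadline k" "0 \<le> energy k"
  shows "(\<lambda>t. if t = arrival k then energy k else 0) \<in> service k"
  using assms by (auto simp: service_def)

lemma loads_nonempty: "valid T ds \<Longrightarrow> loads ds \<noteq> {}"
  by (induction ds) (use service_nonempty in auto)

text \<open>Each profile splits into the share of the first demand and the rest, and the two shares
  are averaged separately with the same weights.\<close>

lemma loads_convex:
  assumes "finite I" "\<And>i. i \<in> I \<Longrightarrow> 0 \<le> l i" "sum l I = 1"
    and "\<And>i. i \<in> I \<Longrightarrow> x i \<in> loads ds"
  shows "(\<lambda>t. \<Sum>i\<in>I. l i * x i t) \<in> loads ds"
  using assms(4)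
proof (induction ds arbitrary: x)
  case (Cons k ds)
  then have "\<forall>i\<in>I. \<exists>y z. y \<in> service k \<and> z \<in> loads ds \<and> x i = (\<lambda>t. y t + z t)"
    by fastforce
  then obtain y z where yz: "\<And>i. i \<in> I \<Longrightarrow> y i \<in> service k" "\<And>i. i \<in> I \<Longrightarrow> z i \<in> loads ds"
      "\<And>i. i \<in> I \<Longrightarrow> x i = (\<lambda>t. y i t + z i t)"
    by metis
  have "(\<Sum>t = arrival k..deadline k. \<Sum>i\<in>I. l i * y i t) = energy k"
  proof -
    have "(\<Sum>t = arrival k..deadline k. \<Sum>i\<in>I. l i * y i t)
        = (\<Sum>i\<in>I. l i * (\<Sum>t = arrival k..deadline k. y i t))"
      by (subst sum.swap) (simp add: sum_distrib_left)
    also have "\<dots> = (\<Sum>i\<in>I. l i * energy k)"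
      using yz(1) by (intro sum.cong) (auto simp: service_def)
    finally show ?thesis using assms(3) by (simp flip: sum_distrib_right)
  qed
  then have "(\<lambda>t. \<Sum>i\<in>I. l i * y i t) \<in> service k"
    using yz(1) assms(2) by (auto simp: service_def intro!: sum_nonneg sum.neutral)
  moreover have "(\<lambda>t. \<Sum>i\<in>I. l i * z i t) \<in> loads ds"
    by (rule Cons.IH[OF yz(2)])
  moreover have "(\<lambda>t. \<Sum>i\<in>I. l i * x i t) = (\<lambda>t. (\<Sum>i\<in>I. l i * y i t) + (\<Sum>i\<in>I. l i * z i t))"
    using yz(3) by (auto simp: distrib_left simp flip: sum.distrib intro!: sum.cong)
  ultimately show ?case by auto
qed simp

lemma service_scale:
  assumes "x \<in> service (Demand (arrival k) (deadline k) e)" "0 < e" "0 \<le> energy k"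
  shows "(\<lambda>t. energy k / e * x t) \<in> service k"
  using assms by (auto simp: service_def simp flip: sum_distrib_left sum_divide_distrib)

text \<open>Each \<open>w i\<close> delivers the full energy \<open>e\<close> in the window of
  subjob \<open>i\<close>; scaling it by that subjob's share of \<open>e\<close> makes it deliver
  exactly the subjob's energy.\<close>

lemma split_loads:
  assumes "0 < e" "valid T ks"
    and "\<And>i. i < length ks \<Longrightarrow> w i \<in> service (Demand (arrival (ks ! i)) (deadline (ks ! i)) e)"
  shows "(\<lambda>t. \<Sum>i<length ks. energy (ks ! i) / e * w i t) \<in> loads ks"
  using assms(2,3)
proof (induction ks arbitrary: w)
  case (Cons k ks)
  have "(\<lambda>t. energy k / e * w 0 t) \<in> service k"
    using service_scale[of "w 0" k e] Cons.prems(1) Cons.prems(2)[of 0] assms(1) by simp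
  moreover have "(\<lambda>t. \<Sum>i<length ks. energy (ks ! i) / e * w (Suc i) t) \<in> loads ks"
    using Cons.prems(1) Cons.prems(2)[of "Suc _"] by (intro Cons.IH) auto
  ultimately show ?case
    unfolding loads.simps length_Cons sum.lessThan_Suc_shift
    by (auto simp: image_iff intro!: bexI)
qed simp

section \<open>Passing between schedules and load profiles\<close>

lemma feasible_Cons:
  "feasible T (k # ds) S \<longleftrightarrow> (\<forall>t\<in>{1..T}. 0 \<le> S 0 t) \<and>
     (\<Sum>t = arrival k..deadline k. S 0 t) = energy k \<and> feasible T ds (\<lambda>i. S (Suc i))"
  by (auto simp: feasible_def All_less_Suc2)

text \<open>A feasible schedule may also spend energy outside a demand's window, where it does not
  count. Cutting this off gives a load profile, hence only an inequality between the loads.\<close>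

lemma feasible_imp_loads:
  assumes "feasible T ds S" "valid T ds"
  shows "\<exists>x\<in>loads ds. \<forall>t\<in>{1..T}. x t \<le> (\<Sum>i<length ds. S i t)"
  using assms
proof (induction ds arbitrary: S)
  case (Cons k ds)
  then obtain x where x: "x \<in> loads ds" "\<forall>t\<in>{1..T}. x t \<le> (\<Sum>i<length ds. S (Suc i) t)"
    using Cons.IH[of "\<lambda>i. S (Suc i)"] unfolding feasible_Cons valid_simps by blast
  define y where "y t = (if t \<in> {arrival k..deadline k} then S 0 t else 0)" for t
  have "y \<in> service k"
    using Cons.prems by (auto simp: service_def y_def feasible_Cons)
  moreover have "y t \<le> S 0 t" if "t \<in> {1..T}" for t
    using Cons.prems that by (auto simp: y_def feasible_Cons)
  ultimately show ?case
    using x by (intro bexI[of _ "\<lambda>t. y t + x t"])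
      (auto simp: sum.lessThan_Suc_shift simp del: sum.lessThan_Suc intro!: add_mono)
qed auto

lemma loads_imp_feasible:
  assumes "x \<in> loads ds"
  shows "\<exists>S. feasible T ds S \<and> (\<forall>t. (\<Sum>i<length ds. S i t) = x t)"
  using assms
proof (induction ds arbitrary: x)
  case (Cons k ds)
  then obtain y z where yz: "y \<in> service k" "z \<in> loads ds" "x = (\<lambda>t. y t + z t)"
    by auto
  obtain S where S: "feasible T ds S" "\<forall>t. (\<Sum>i<length ds. S i t) = z t"
    using Cons.IH[OF yz(2)] by blast
  \<comment> \<open>\<open>case_nat y S\<close> puts the row \<open>y\<close> of the new demand in
    front of the rows of \<open>S\<close>.\<close>
  have "feasible T (k # ds) (case_nat y S)"
    using yz S by (auto simp: feasible_Cons service_def)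
  then show ?case
    using yz S by (intro exI[of _ "case_nat y S"])
      (simp add: sum.lessThan_Suc_shift del: sum.lessThan_Suc)
qed (auto simp: feasible_def)

section \<open>Continuity of the cost function and existence of the optimal cost\<close>

text \<open>Convexity yields continuity only in the open half-line. At \<open>0\<close>,
  monotonicity bounds \<open>C\<close> below by \<open>C 0\<close>, and the chord from
  \<open>0\<close> to \<open>1\<close> bounds it above; both bounds tend to
  \<open>C 0\<close>.\<close>

lemma mono_convex_imp_continuous:
  fixes C :: "real \<Rightarrow> real"
  assumes "mono_on {0..} C" "convex_on {0..} C"
  shows "continuous_on {0..} C"
  unfolding continuous_on_eq_continuous_within
proof
  fix x :: real
  assume "x \<in> {0..}"
  show "continuous (at x within {0..}) C"
  proof (cases "x = 0")
    case False
    have "convex_on {0<..} C"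
      using assms(2) by (rule convex_on_subset) auto
    then have "continuous_on {0<..} C"
      by (intro convex_on_continuous) auto
    then have "isCont C x"
      using False \<open>x \<in> {0..}\<close> by (intro continuous_on_interior[of "{0<..}"]) (auto simp: interior_open)
    then show ?thesis by (rule continuous_at_imp_continuous_at_within)
  next
    case True
    have upper: "C y \<le> (1 - y) * C 0 + y * C 1" if "0 \<le> y" "y \<le> 1" for y
      using convex_onD[OF assms(2), of y 0 1] that by simp
    have ev: "eventually (\<lambda>y::real. 0 \<le> y \<and> y \<le> 1) (at 0 within {0..})"
      unfolding eventually_at by (intro exI[of _ 1]) (auto simp: dist_real_def)
    have "(C \<longlongrightarrow> C 0) (at 0 within {0..})"
    proof (rule tendsto_sandwich)
      show "eventually (\<lambda>y. C 0 \<le> C y) (at 0 within {0..})"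
        using ev by eventually_elim (auto intro: mono_onD[OF assms(1)])
      show "eventually (\<lambda>y. C y \<le> (1 - y) * C 0 + y * C 1) (at 0 within {0..})"
        using ev by eventually_elim (use upper in auto)
      show "((\<lambda>y. (1 - y) * C 0 + y * C 1) \<longlongrightarrow> C 0) (at 0 within {0..})"
        by (auto intro!: tendsto_eq_intros)
    qed simp
    then show ?thesis using True by (simp add: continuous_within)
  qed
qed

text \<open>The minimiser comes from compactness of \<open>loads ds\<close>. It is also the
  \<open>LEAST\<close> over schedules: it is realised by a schedule, and every schedule dominates
  some load profile, which by monotonicity costs no more.\<close>

lemma C_min_attained:
  assumes "mono_on {0..} C" "convex_on {0..} C" "valid T ds"
  obtains x where "x \<in> loads ds" "C_min C T ds = (\<Sum>t = 1..T. C (x t))"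
    "\<And>y. y \<in> loads ds \<Longrightarrow> C_min C T ds \<le> (\<Sum>t = 1..T. C (y t))"
proof -
  have coord: "continuous_on S (\<lambda>x::nat \<Rightarrow> real. x t)" for t S
    by (rule continuous_on_subset[OF continuous_on_product_coordinates]) simp
  have "continuous_on (loads ds) (\<lambda>x. \<Sum>t = 1..T. C (x t))"
    using loads_nonneg
    by (intro continuous_on_sum
        continuous_on_compose2[OF mono_convex_imp_continuous[OF assms(1,2)] coord]) auto
  from continuous_attains_inf[OF compact_loads loads_nonempty[OF assms(3)] this]
  obtain x where x: "x \<in> loads ds"
      "\<And>y. y \<in> loads ds \<Longrightarrow> (\<Sum>t = 1..T. C (x t)) \<le> (\<Sum>t = 1..T. C (y t))"
    by blast
  obtain S0 where S0: "feasible T ds S0" "\<forall>t. (\<Sum>i<length ds. S0 i t) = x t"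
    using loads_imp_feasible[OF x(1)] by blast
  have "C_min C T ds = (\<Sum>t = 1..T. C (x t))"
    unfolding C_min_def
  proof (rule Least_equality)
    show "\<exists>S. feasible T ds S \<and> (\<Sum>t = 1..T. C (x t)) = schedule_cost C T ds S"
      using S0 by (auto simp: schedule_cost_def)
  next
    fix c
    assume "\<exists>S. feasible T ds S \<and> c = schedule_cost C T ds S"
    then obtain S where S: "feasible T ds S" "c = schedule_cost C T ds S" by blast
    obtain y where y: "y \<in> loads ds" "\<forall>t\<in>{1..T}. y t \<le> (\<Sum>i<length ds. S i t)"
      using feasible_imp_loads[OF S(1) assms(3)] by blast
    have "(\<Sum>t = 1..T. C (y t)) \<le> (\<Sum>t = 1..T. C (\<Sum>i<length ds. S i t))"
      using y(2) loads_nonneg[OF y(1)]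
      by (intro sum_mono mono_onD[OF assms(1)]) (fastforce intro: order_trans)+
    then show "(\<Sum>t = 1..T. C (x t)) \<le> c"
      using x(2)[OF y(1)] S(2) by (simp add: schedule_cost_def)
  qed
  with x show ?thesis by (intro that) auto
qed

lemma C_min_le:
  assumes "mono_on {0..} C" "convex_on {0..} C" "valid T ds" "x \<in> loads ds"
  shows "C_min C T ds \<le> (\<Sum>t = 1..T. C (x t))"
  by (rule C_min_attained[OF assms(1-3)]) (use assms(4) in blast)

text \<open>
  Splitting a job is a convex combination, with weights \<open>energy k / e\<close>, of concentrating all its
  energy on one of the subjobs \<open>k\<close>; the same combination of optimal schedules is feasible.
\<close>

lemma C_min_concentrate:
  assumes C: "mono_on {0..} C" "convex_on {0..} C"
    and valid: "valid T (pre @ ks @ post)"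
    and e: "(\<Sum>k\<leftarrow>ks. energy k) = e" "0 < e"
  shows "\<exists>k\<in>set ks. C_min C T (pre @ ks @ post)
    \<le> C_min C T (pre @ [Demand (arrival k) (deadline k) e] @ post)"
proof (rule ccontr)
  define m where "m = C_min C T (pre @ ks @ post)"
  define l where "l i = energy (ks ! i) / e" for i
  define D where "D i = Demand (arrival (ks ! i)) (deadline (ks ! i)) e" for i
  let ?I = "{..<length ks}"
  assume "\<not> ?thesis"
  then have less: "C_min C T (pre @ [D i] @ post) < m" if "i \<in> ?I" for i
    using that by (auto simp: m_def D_def not_le)
  have valid_D: "valid T (pre @ [D i] @ post)" if "i \<in> ?I" for i
    using valid that e(2) by (auto simp: D_def valid_def)
  \<comment> \<open>An optimal profile of each concentrated family is cut into the loads of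
    \<open>pre\<close>, of the concentrated subjob and of \<open>post\<close>, so that the three
    parts can be averaged separately.\<close>
  have "\<forall>i\<in>?I. \<exists>u w v. u \<in> loads pre \<and> w \<in> service (D i) \<and> v \<in> loads post \<and>
      (\<Sum>t = 1..T. C (u t + (w t + v t))) < m"
  proof
    fix i assume i: "i \<in> ?I"
    obtain x where x: "x \<in> loads (pre @ [D i] @ post)"
        "C_min C T (pre @ [D i] @ post) = (\<Sum>t = 1..T. C (x t))"
      by (rule C_min_attained[OF C valid_D[OF i]])
    from x(1) obtain u w v where
        "u \<in> loads pre" "w \<in> service (D i)" "v \<in> loads post" "x = (\<lambda>t. u t + (w t + v t))"
      by (auto simp: loads_append)
    with x less[OF i] show "\<exists>u w v. u \<in> loads pre \<and> w \<in> service (D i) \<and> v \<in> loads post \<and>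
      (\<Sum>t = 1..T. C (u t + (w t + v t))) < m" by auto
  qed
  then obtain u w v where uwv: "\<And>i. i \<in> ?I \<Longrightarrow> u i \<in> loads pre"
      "\<And>i. i \<in> ?I \<Longrightarrow> w i \<in> service (D i)" "\<And>i. i \<in> ?I \<Longrightarrow> v i \<in> loads post"
      "\<And>i. i \<in> ?I \<Longrightarrow> (\<Sum>t = 1..T. C (u i t + (w i t + v i t))) < m"
    unfolding bchoice_iff by blast
  have l_nonneg: "0 \<le> l i" if "i \<in> ?I" for i
    using valid that e(2) by (auto simp: l_def valid_def)
  have l_sum: "sum l ?I = 1"
    using e by (simp add: l_def sum_list_sum_nth atLeast0LessThan flip: sum_divide_distrib)
  let ?y = "\<lambda>t. (\<Sum>i\<in>?I. l i * u i t) + ((\<Sum>i\<in>?I. l i * w i t) + (\<Sum>i\<in>?I. l i * v i t))"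
  have "?y \<in> loads (pre @ ks @ post)"
  proof (intro loads_appendI)
    show "(\<lambda>t. \<Sum>i\<in>?I. l i * w i t) \<in> loads ks"
      unfolding l_def using uwv(2) valid e(2) by (intro split_loads) (auto simp: D_def)
  qed (use uwv l_nonneg l_sum in \<open>auto intro!: loads_convex\<close>)
  then have "m \<le> (\<Sum>t = 1..T. C (?y t))"
    unfolding m_def by (rule C_min_le[OF C valid])
  also have "\<dots> = (\<Sum>t = 1..T. C (\<Sum>i\<in>?I. l i *\<^sub>R (u i t + (w i t + v i t))))"
    by (simp add: distrib_left sum.distrib)
  \<comment> \<open>Jensen's inequality in every slot.\<close>
  also have "\<dots> \<le> (\<Sum>t = 1..T. \<Sum>i\<in>?I. l i * C (u i t + (w i t + v i t)))"
  proof (rule sum_mono, rule convex_on_sum[OF _ _ C(2) l_sum])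
    fix t i assume i: "i \<in> ?I"
    have "0 \<le> w i t" using uwv(2)[OF i] by (simp add: service_def)
    then show "u i t + (w i t + v i t) \<in> {0..}"
      using loads_nonneg[OF uwv(1)[OF i]] loads_nonneg[OF uwv(3)[OF i]] by simp
  qed (use l_sum l_nonneg in auto)
  also have "\<dots> = (\<Sum>i\<in>?I. l i * (\<Sum>t = 1..T. C (u i t + (w i t + v i t))))"
    by (subst sum.swap) (simp add: sum_distrib_left)
  \<comment> \<open>The weights sum to \<open>1\<close>, so at least one is positive; this keeps the
    inequality strict although some subjobs may have energy \<open>0\<close>.\<close>
  also have "\<dots> < (\<Sum>i\<in>?I. l i * m)"
  proof (rule sum_strict_mono_ex1)
    obtain i where "i \<in> ?I" "l i > 0"
      using l_sum sum_nonpos[of ?I l] by fastforce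
    then show "\<exists>i\<in>?I. l i * (\<Sum>t = 1..T. C (u i t + (w i t + v i t))) < l i * m"
      using uwv(4) by (blast intro: mult_strict_left_mono)
    show "\<forall>i\<in>?I. l i * (\<Sum>t = 1..T. C (u i t + (w i t + v i t))) \<le> l i * m"
      by (intro ballI mult_left_mono less_imp_le uwv(4) l_nonneg)
  qed simp
  also have "\<dots> = m"
    using l_sum by (simp flip: sum_distrib_right)
  finally show False by simp
qed

section \<open>Shortened windows and single-job updates of an attack\<close>

text \<open>The parameter \<open>h\<close> chooses a new deadline. Returning the old deadline gives
  the optimal cost, returning the arrival forces immediate service. As \<open>h\<close> does not see
  the energy, shortening commutes with concentrating energy on a subjob.\<close>

definition shorten :: "(nat \<Rightarrow> nat \<Rightarrow> nat) \<Rightarrow> demand \<Rightarrow> demand" where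
  "shorten h k = Demand (arrival k) (h (arrival k) (deadline k)) (energy k)"

lemma shorten_simps [simp]:
  "arrival (shorten h k) = arrival k"
  "deadline (shorten h k) = h (arrival k) (deadline k)"
  "energy (shorten h k) = energy k"
  by (simp_all add: shorten_def)

lemma shorten_deadline [simp]: "shorten (\<lambda>a d. d) = (\<lambda>k. k)"
  by (auto simp: shorten_def)

lemma valid_shorten:
  assumes "\<And>a d. a \<le> d \<Longrightarrow> a \<le> h a d \<and> h a d \<le> d" "valid T ds"
  shows "valid T (map (shorten h) ds)"
  using assms by (fastforce simp: valid_def)

lemma forged_upd:
  assumes "j \<in> {1..n}"
  shows "forged n (b(j := ks)) = concat (map b [1..<j]) @ ks @ concat (map b [Suc j..<Suc n])"
proof -
  have "[1..<Suc n] = [1..<j] @ j # [Suc j..<Suc n]"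
    using assms upt_add_eq_append[of 1 j "Suc n - j"] by (simp add: upt_conv_Cons)
  then show ?thesis by (auto simp: forged_def intro!: arg_cong[where f = concat])
qed

section \<open>Existence of a worst attack\<close>

locale jobs =
  fixes C :: "real \<Rightarrow> real" and T n :: nat and job :: "nat \<Rightarrow> demand" and \<beta> :: real
  assumes mono: "mono_on {0..} C" and convex: "convex_on {0..} C"
    and job: "\<And>j. j \<in> {1..n} \<Longrightarrow> 1 \<le> arrival (job j) \<and> arrival (job j) \<le> deadline (job j) \<and>
      deadline (job j) \<le> T \<and> 0 < energy (job j)"
    and \<beta>: "0 \<le> \<beta>"
begin

lemma valid_forged:
  assumes "attack n job \<beta> b"
  shows "valid T (forged n b)"
  using assms job by (fastforce simp: attack_def replaces_def forged_def valid_def)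

lemma attack_job: "attack n job \<beta> (\<lambda>j. [job j])"
  using job \<beta> by (fastforce simp: attack_def replaces_def modified_jobs_def)

text \<open>An unmodified job is already a single demand. A modified job is already counted in the
  budget, so concentrating it cannot increase the number of modified jobs.\<close>

lemma concentrate_attack:
  assumes h: "\<And>a d. a \<le> d \<Longrightarrow> a \<le> h a d \<and> h a d \<le> d"
    and b: "attack n job \<beta> b" and j: "j \<in> {1..n}"
  shows "\<exists>k. attack n job \<beta> (b(j := [k])) \<and> C_min C T (map (shorten h) (forged n b))
    \<le> C_min C T (map (shorten h) (forged n (b(j := [k]))))"
proof (cases "b j = [job j]")
  case True
  then show ?thesis using b by (intro exI[of _ "job j"]) (simp add: fun_upd_idem)
next
  case False
  let ?f = "map (shorten h)"
  let ?pre = "?f (concat (map b [1..<j]))" and ?post = "?f (concat (map b [Suc j..<Suc n]))"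
  have rep: "replaces (b j) (job j)" using b j by (simp add: attack_def)
  have eq: "?f (forged n b) = ?pre @ ?f (b j) @ ?post"
    using forged_upd[OF j, of b "b j"] by (simp add: fun_upd_idem)
  have "valid T (?pre @ ?f (b j) @ ?post)"
    using valid_shorten[OF h valid_forged[OF b]] eq by simp
  moreover have "(\<Sum>k\<leftarrow>?f (b j). energy k) = energy (job j)"
    using rep by (simp add: replaces_def o_def)
  ultimately obtain k where k: "k \<in> set (b j)" "C_min C T (?f (forged n b)) \<le> C_min C T (?pre @
      [Demand (arrival k) (h (arrival k) (deadline k)) (energy (job j))] @ ?post)"
    using C_min_concentrate[OF mono convex, of T ?pre "?f (b j)" ?post] job[OF j] eq by auto
  \<comment> \<open>The forged job keeps the unshortened window of \<open>k\<close>, so that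
    \<open>shorten h q\<close> is the demand produced by the concentration.\<close>
  define q where "q = Demand (arrival k) (deadline k) (energy (job j))"
  have "replaces [q] (job j)"
    using rep k(1) job[OF j] by (auto simp: replaces_def q_def)
  moreover have "card (modified_jobs n job (b(j := [q]))) \<le> card (modified_jobs n job b)"
    using j False by (intro card_mono) (auto simp: modified_jobs_def)
  ultimately have "attack n job \<beta> (b(j := [q]))"
    using b unfolding attack_def by (auto intro: order_trans[OF of_nat_mono])
  then show ?thesis
    using k(2) by (intro exI[of _ q]) (simp add: forged_upd[OF j] shorten_def q_def)
qed

lemma single_subjobs_attack:
  assumes h: "\<And>a d. a \<le> d \<Longrightarrow> a \<le> h a d \<and> h a d \<le> d"
    and b: "attack n job \<beta> b" and "m \<le> n"
  shows "\<exists>b'. attack n job \<beta> b' \<and> (\<forall>j\<in>{1..m}. length (b' j) = 1) \<and>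
    C_min C T (map (shorten h) (forged n b)) \<le> C_min C T (map (shorten h) (forged n b'))"
  using \<open>m \<le> n\<close>
proof (induction m)
  case 0
  then show ?case using b by auto
next
  case (Suc m)
  then obtain b' where b': "attack n job \<beta> b'" "\<forall>j\<in>{1..m}. length (b' j) = 1"
      "C_min C T (map (shorten h) (forged n b)) \<le> C_min C T (map (shorten h) (forged n b'))"
    by auto
  obtain k where "attack n job \<beta> (b'(Suc m := [k]))" "C_min C T (map (shorten h) (forged n b'))
      \<le> C_min C T (map (shorten h) (forged n (b'(Suc m := [k]))))"
    using concentrate_attack[OF h b'(1), of "Suc m"] Suc.prems by auto
  moreover have "\<forall>j\<in>{1..Suc m}. length ((b'(Suc m := [k])) j) = 1"
    using b'(2) by (auto simp: le_Suc_eq)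
  ultimately show ?case
    using b'(3) by (blast intro: order_trans)
qed

text \<open>With one subjob per job the energy is forced and only a window within
  \<open>{..T}\<close> remains to be chosen. So these attacks have finitely many costs, and every
  attack is dominated by one of them.\<close>

lemma max_attack:
  assumes h: "\<And>a d. a \<le> d \<Longrightarrow> a \<le> h a d \<and> h a d \<le> d"
  shows "\<exists>b. attack n job \<beta> b \<and> (\<forall>b'. attack n job \<beta> b' \<longrightarrow>
    C_min C T (map (shorten h) (forged n b')) \<le> C_min C T (map (shorten h) (forged n b)))"
proof -
  define V where "V b = C_min C T (map (shorten h) (forged n b))" for b
  define P where "P = {b. attack n job \<beta> b \<and> (\<forall>j\<in>{1..n}. length (b j) = 1)}"
  define F where "F j = (\<lambda>(a, d). [Demand a d (energy (job j))]) ` ({..T} \<times> {..T})" for j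
  have "V ` P \<subseteq> V ` PiE {1..n} F"
  proof
    fix c assume "c \<in> V ` P"
    then obtain b where b: "b \<in> P" "c = V b" by blast
    have "b j \<in> F j" if j: "j \<in> {1..n}" for j
    proof -
      from b j have rep: "replaces (b j) (job j)" and "length (b j) = 1"
        by (auto simp: P_def attack_def)
      then obtain a d e where "b j = [Demand a d e]"
        by (metis One_nat_def demand.exhaust length_0_conv length_Suc_conv)
      with rep job[OF j] show ?thesis by (auto simp: F_def replaces_def image_iff)
    qed
    \<comment> \<open>Members of \<open>P\<close> are arbitrary outside \<open>{1..n}\<close>, so
      finiteness is shown for the costs and not for \<open>P\<close>; restriction does not affect
      the forged family.\<close>
    moreover have "forged n (restrict b {1..n}) = forged n b"
      by (auto simp: forged_def intro!: arg_cong[where f = concat])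
    ultimately show "c \<in> V ` PiE {1..n} F"
      using b by (intro image_eqI[of _ _ "restrict b {1..n}"]) (auto simp: V_def)
  qed
  moreover have "finite (PiE {1..n} F)"
    by (intro finite_PiE) (auto simp: F_def)
  ultimately have fin: "finite (V ` P)"
    by (meson finite_imageI finite_subset)
  have "P \<noteq> {}" using attack_job by (auto simp: P_def)
  then obtain b where b: "b \<in> P" "V b = Max (V ` P)"
    using Max_in[OF fin] by fastforce
  show ?thesis
  proof (intro exI conjI allI impI)
    show "attack n job \<beta> b" using b by (simp add: P_def)
    fix b' assume "attack n job \<beta> b'"
    from single_subjobs_attack[OF h this order_refl]
    obtain b'' where "b'' \<in> P" "V b' \<le> V b''" by (auto simp: P_def V_def)
    then show "C_min C T (map (shorten h) (forged n b')) \<le> C_min C T (map (shorten h) (forged n b))"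
      using b Max_ge[OF fin, of "V b''"] by (auto simp: V_def)
  qed
qed

end

section \<open>Baseline cost against optimal cost\<close>

lemma service_shorten:
  assumes "arrival k \<le> h (arrival k) (deadline k)" "h (arrival k) (deadline k) \<le> deadline k"
  shows "service (shorten h k) \<subseteq> service k"
proof
  fix x assume x: "x \<in> service (shorten h k)"
  have "(\<Sum>t = arrival k..deadline k. x t) = (\<Sum>t = arrival k..h (arrival k) (deadline k). x t)"
    using x assms by (intro sum.mono_neutral_right) (auto simp: service_def)
  then show "x \<in> service k"
    using x assms by (auto simp: service_def)
qed

lemma loads_shorten:
  assumes "\<And>a d. a \<le> d \<Longrightarrow> a \<le> h a d \<and> h a d \<le> d" "valid T ds"
  shows "loads (map (shorten h) ds) \<subseteq> loads ds"
  using assms(2)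
proof (induction ds)
  case (Cons k ds)
  moreover have "service (shorten h k) \<subseteq> service k"
    using assms(1) Cons.prems by (intro service_shorten) auto
  ultimately show ?case by auto
qed simp

text \<open>Shorter windows leave fewer load profiles to minimise over.\<close>

lemma C_min_shorten:
  assumes C: "mono_on {0..} C" "convex_on {0..} C"
    and h: "\<And>a d. a \<le> d \<Longrightarrow> a \<le> h a d \<and> h a d \<le> d" and ds: "valid T ds"
  shows "C_min C T ds \<le> C_min C T (map (shorten h) ds)"
proof -
  obtain x where "x \<in> loads (map (shorten h) ds)"
      "C_min C T (map (shorten h) ds) = (\<Sum>t = 1..T. C (x t))"
    by (rule C_min_attained[OF C valid_shorten[OF h ds]])
  moreover from this(1) have "x \<in> loads ds" using loads_shorten[OF h ds] by blast
  ultimately show ?thesis using C_min_le[OF C ds] by metis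
qed

lemma loads_shorten_arrival:
  assumes "valid T ds"
  shows "loads (map (shorten (\<lambda>a d. a)) ds)
    = {\<lambda>t. \<Sum>i<length ds. if arrival (ds ! i) = t then energy (ds ! i) else 0}"
  using assms
proof (induction ds)
  case (Cons k ds)
  have "service (shorten (\<lambda>a d. a) k) = {\<lambda>t. if arrival k = t then energy k else 0}"
    using Cons.prems by (auto simp: service_def fun_eq_iff)
  then show ?case
    using Cons by (simp add: sum.lessThan_Suc_shift del: sum.lessThan_Suc cong: if_cong)
qed simp

text \<open>With one-slot windows the only load profile is the baseline one. Arrivals are at least
  \<open>1\<close>, so slot \<open>0\<close> carries no load and accounts for the extra
  \<open>C 0\<close>.\<close>

lemma C_base_eq_C_min:
  assumes C: "mono_on {0..} C" "convex_on {0..} C" and ds: "valid T ds"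
  shows "C_base C T ds = C 0 + C_min C T (map (shorten (\<lambda>a d. a)) ds)"
proof -
  let ?x = "\<lambda>t. \<Sum>i<length ds. if arrival (ds ! i) = t then energy (ds ! i) else 0"
  have x: "(\<Sum>i | i < length ds \<and> arrival (ds ! i) = t. energy (ds ! i)) = ?x t" for t
    using sum.inter_filter[of "{..<length ds}" "\<lambda>i. energy (ds ! i)" "\<lambda>i. arrival (ds ! i) = t"]
    by simp
  have "valid T (map (shorten (\<lambda>a d. a)) ds)"
    using ds by (intro valid_shorten) auto
  then obtain y where y: "y \<in> loads (map (shorten (\<lambda>a d. a)) ds)"
      "C_min C T (map (shorten (\<lambda>a d. a)) ds) = (\<Sum>t = 1..T. C (y t))"
    by (rule C_min_attained[OF C])
  have "y = ?x"
    using y(1) unfolding loads_shorten_arrival[OF ds] by (rule singletonD)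
  then have "C_min C T (map (shorten (\<lambda>a d. a)) ds) = (\<Sum>t = 1..T. C (?x t))"
    using y(2) by simp
  moreover have "?x 0 = 0"
    using ds by (intro sum.neutral) (fastforce simp: valid_def dest: nth_mem)
  ultimately show ?thesis
    by (simp add: C_base_def x sum.atLeast_Suc_atMost)
qed

theorem lemma5:
  fixes C :: "real \<Rightarrow> real" and T n :: nat and job :: "nat \<Rightarrow> demand" and \<beta> :: real
  assumes "\<And>x. 0 \<le> x \<Longrightarrow> 0 \<le> C x"
    and "mono_on {0..} C"
    and "convex_on {0..} C"
    and "1 \<le> n"
    and "\<And>j. j \<in> {1..n} \<Longrightarrow> arrival (job j) \<in> {1..T}"
    and "\<And>j. j \<in> {1..n} \<Longrightarrow> deadline (job j) \<in> {1..T}"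
    and "\<And>j. j \<in> {1..n} \<Longrightarrow> arrival (job j) \<le> deadline (job j)"
    and "\<And>j. j \<in> {1..n} \<Longrightarrow> 0 < energy (job j)"
    and "\<beta> \<in> {0..1}"
  shows "C2_maxmin C T n job \<beta> \<ge> C_maxmin C T n job \<beta>"
proof -
  interpret jobs C T n job \<beta>
    using assms by unfold_locales auto
  let ?trunc = "map (shorten (\<lambda>a d. a))"
  \<comment> \<open>\<open>b1\<close> is worst for the optimal cost and \<open>b2\<close> for
    immediate service.\<close>
  obtain b1 where b1: "attack n job \<beta> b1"
      "\<And>b. attack n job \<beta> b \<Longrightarrow> C_min C T (forged n b) \<le> C_min C T (forged n b1)"
    using max_attack[of "\<lambda>a d. d"] by auto
  obtain b2 where b2: "attack n job \<beta> b2"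
      "\<And>b. attack n job \<beta> b \<Longrightarrow> C_min C T (?trunc (forged n b)) \<le> C_min C T (?trunc (forged n b2))"
    using max_attack[of "\<lambda>a d. a"] by auto
  have base: "C_base C T (forged n b) = C 0 + C_min C T (?trunc (forged n b))"
    if "attack n job \<beta> b" for b
    using C_base_eq_C_min[OF mono convex valid_forged[OF that]] .
  have "C_maxmin C T n job \<beta> = C_min C T (forged n b1)"
    unfolding C_maxmin_def using b1 by (intro Greatest_equality) auto
  also have "\<dots> \<le> C_min C T (?trunc (forged n b1))"
    using valid_forged[OF b1(1)] by (intro C_min_shorten mono convex) auto
  \<comment> \<open>\<open>b1\<close> need not be worst for the baseline, but \<open>b2\<close>
    dominates it there; the term \<open>C 0\<close> is nonnegative.\<close>
  also have "\<dots> \<le> C_base C T (forged n b2)"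
    using b2(2)[OF b1(1)] base[OF b2(1)] assms(1)[of 0] by simp
  also have "\<dots> = C2_maxmin C T n job \<beta>"
    unfolding C2_maxmin_def using b2 base by (intro Greatest_equality[symmetric]) auto
  finally show ?thesis .
qed

end
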